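(* Let $\mathcal{H}, \mathcal{K}$ be closed subspaces of $L^2$, let $a_1, a_2 \in \mathscr{G}L^\infty$ with $a_i \mathcal{K} = \mathcal{H}$ for $i = 1,2$, and let $\phi, \psi \in L^\infty$ with $\phi = \bar a_2 \psi a_1$, so that $T_\phi^{\mathcal{K}} = E\, T_\psi^{\mathcal{H}} F$ with $E = T_{\bar a_2}^{\mathcal{H},\mathcal{K}}$ and $F = T_{a_1}^{\mathcal{K},\mathcal{H}} = M_{a_1}|_{\mathcal{K}}$. Then the following are equivalent: (a) the operators $T_\phi^{\mathcal{K}}$ and $T_\psi^{\mathcal{H}}$ are similar via the identity $T_\phi^{\mathcal{K}} = E\, T_\psi^{\mathcal{H}} F$; (b) $E = F^{-1}$; (c) $T_{\bar a_2 - a_1^{-1}}^{\mathcal{H},\mathcal{K}} = 0$; (d) $T_{\bar a_2^{-1} - a_1}^{\mathcal{K},\mathcal{H}} = 0$; (e) $T_{1 - \bar a_2 a_1}^{\mathcal{K}} = 0$; (f) $T_{1 - \bar a_2^{-1} a_1^{-1}}^{\mathcal{H}} = 0$.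
   Context: $L^2 = L^2(\mathbb{T}, m)$, with $m$ normalized Lebesgue measure on the unit circle $\mathbb{T}$, and $L^\infty = L^\infty(\mathbb{T},m)$ (complex-valued functions). $\mathscr{G}L^\infty = \{g \in L^\infty : 1/g \in L^\infty\}$. $M_a$ is the multiplication operator $f\mapsto af$ on $L^2$, and $a\mathcal{K} = \{af: f \in \mathcal{K}\}$. $P_{\mathcal{N}}$ is the orthogonal projection of $L^2$ onto the closed subspace $\mathcal{N}$. For closed subspaces $\mathcal{M}, \mathcal{N}$ of $L^2$ and $\phi \in L^\infty$, $T_\phi^{\mathcal{M},\mathcal{N}} : \mathcal{M} \to \mathcal{N}$ is $T_\phi^{\mathcal{M},\mathcal{N}} f = P_{\mathcal{N}}(\phi f)$, and $T_\phi^{\mathcal{M}} = T_\phi^{\mathcal{M},\mathcal{M}}$. "Similar via the identity $T_\phi^{\mathcal{K}} = E T_\psi^{\mathcal{H}} F$" means that this identity itself is a similarity, i.e. the outer factors $E:\mathcal{H}\to\mathcal{K}$ and $F:\mathcal{K}\to\mathcal{H}$ are inverse to each other. *)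

theory Defs
  imports "HOL-Analysis.Analysis"
begin

text \<open>Normalized Lebesgue measure on the unit circle: the image of the uniform distribution on
  \<open>[0, 2 * pi]\<close> under \<open>t \<mapsto> exp (i t)\<close>.\<close>

definition circle :: "complex measure" where
  "circle = distr (uniform_measure lborel {0..2 * pi}) (restrict_space borel (sphere 0 1)) cis"

definition sq_integrable :: "(complex \<Rightarrow> complex) \<Rightarrow> bool" where
  "sq_integrable f \<longleftrightarrow>
     f \<in> borel_measurable circle \<and> integrable circle (\<lambda>z. (cmod (f z))\<^sup>2)"

lemma sq_integrable_mult:
  assumes "sq_integrable f" "sq_integrable g"
  shows "integrable circle (\<lambda>z. f z * g z)"
proof (rule Bochner_Integration.integrable_bound)
  show "integrable circle (\<lambda>z. (cmod (f z))\<^sup>2 + (cmod (g z))\<^sup>2)"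
    using assms by (simp add: sq_integrable_def)
  show "(\<lambda>z. f z * g z) \<in> borel_measurable circle"
    using assms by (auto simp: sq_integrable_def)
  have "cmod (f z * g z) \<le> (cmod (f z))\<^sup>2 + (cmod (g z))\<^sup>2" for z
  proof -
    have "2 * cmod (f z) * cmod (g z) \<le> (cmod (f z))\<^sup>2 + (cmod (g z))\<^sup>2"
      by (rule sum_squares_bound)
    moreover have "0 \<le> cmod (f z) * cmod (g z)" by simp
    ultimately show ?thesis unfolding norm_mult by linarith
  qed
  then show "AE z in circle.
      norm (f z * g z) \<le> norm ((cmod (f z))\<^sup>2 + (cmod (g z))\<^sup>2)" by simp
qed

lemma sq_integrable_cnj:
  assumes "sq_integrable f"
  shows "sq_integrable (\<lambda>z. cnj (f z))"
proof -
  have "f \<in> borel_measurable circle" using assms by (simp add: sq_integrable_def)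
  then have "(\<lambda>z. cnj (f z)) \<in> borel_measurable circle"
    by (rule borel_measurable_continuous_on[rotated]) (intro continuous_intros)
  then show ?thesis using assms by (simp add: sq_integrable_def)
qed

lemma sq_integrable_zero: "sq_integrable (\<lambda>_. 0)"
  by (simp add: sq_integrable_def)

lemma sq_integrable_add:
  assumes "sq_integrable f" "sq_integrable g"
  shows "sq_integrable (\<lambda>z. f z + g z)"
  unfolding sq_integrable_def
proof
  show m: "(\<lambda>z. f z + g z) \<in> borel_measurable circle"
    using assms by (auto simp: sq_integrable_def)
  show "integrable circle (\<lambda>z. (cmod (f z + g z))\<^sup>2)"
  proof (rule Bochner_Integration.integrable_bound)
    show "integrable circle (\<lambda>z. 2 * (cmod (f z))\<^sup>2 + 2 * (cmod (g z))\<^sup>2)"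
      using assms by (simp add: sq_integrable_def)
    show "(\<lambda>z. (cmod (f z + g z))\<^sup>2) \<in> borel_measurable circle"
      using m by simp
    have "(cmod (f z + g z))\<^sup>2 \<le> 2 * (cmod (f z))\<^sup>2 + 2 * (cmod (g z))\<^sup>2" for z
    proof -
      have "(cmod (f z + g z))\<^sup>2 \<le> (cmod (f z) + cmod (g z))\<^sup>2"
        by (intro power_mono norm_triangle_ineq) auto
      also have "\<dots> \<le> 2 * (cmod (f z))\<^sup>2 + 2 * (cmod (g z))\<^sup>2"
        using sum_squares_bound[of "cmod (f z)" "cmod (g z)"] by (simp add: power2_sum)
      finally show ?thesis .
    qed
    then show "AE z in circle. norm ((cmod (f z + g z))\<^sup>2)
        \<le> norm (2 * (cmod (f z))\<^sup>2 + 2 * (cmod (g z))\<^sup>2)" by simp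
  qed
qed

definition Linf :: "(complex \<Rightarrow> complex) set" where
  "Linf = {a \<in> borel_measurable circle. \<exists>C. AE z in circle. cmod (a z) \<le> C}"

text \<open>The nonvanishing condition is needed because of the convention \<open>1 / 0 = 0\<close>.\<close>

definition GLinf :: "(complex \<Rightarrow> complex) set" where
  "GLinf = {g \<in> Linf. (AE z in circle. g z \<noteq> 0) \<and> (\<lambda>z. 1 / g z) \<in> Linf}"

lemma sq_integrable_Linf_mult:
  assumes "a \<in> Linf" "sq_integrable f"
  shows "sq_integrable (\<lambda>z. a z * f z)"
proof -
  obtain C where C: "AE z in circle. cmod (a z) \<le> C" using assms by (auto simp: Linf_def)
  have m: "(\<lambda>z. a z * f z) \<in> borel_measurable circle"
    using assms by (auto simp: sq_integrable_def Linf_def)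
  have "integrable circle (\<lambda>z. (cmod (a z * f z))\<^sup>2)"
  proof (rule Bochner_Integration.integrable_bound)
    show "integrable circle (\<lambda>z. C\<^sup>2 * (cmod (f z))\<^sup>2)"
      using assms by (simp add: sq_integrable_def)
    show "(\<lambda>z. (cmod (a z * f z))\<^sup>2) \<in> borel_measurable circle" using m by simp
    show "AE z in circle. norm ((cmod (a z * f z))\<^sup>2) \<le> norm (C\<^sup>2 * (cmod (f z))\<^sup>2)"
      using C
    proof eventually_elim
      case (elim z)
      then have "(cmod (a z))\<^sup>2 \<le> C\<^sup>2" by (intro power_mono) auto
      then show ?case by (simp add: norm_mult power_mult_distrib mult_right_mono)
    qed
  qed
  with m show ?thesis by (simp add: sq_integrable_def)
qed

lemma const_in_Linf: "(\<lambda>_. c) \<in> Linf"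
  by (auto simp: Linf_def)

lemma sq_integrable_scale: "sq_integrable f \<Longrightarrow> sq_integrable (\<lambda>z. c * f z)"
  using sq_integrable_Linf_mult[OF const_in_Linf] .

lemma sq_integrable_scaleR: "sq_integrable f \<Longrightarrow> sq_integrable (\<lambda>z. r *\<^sub>R f z)"
  using sq_integrable_scale[of f "of_real r"] by (simp add: scaleR_conv_of_real)

quotient_type l2 = "complex \<Rightarrow> complex" /
  partial: "\<lambda>f g. sq_integrable f \<and> sq_integrable g \<and> (AE z in circle. f z = g z)"
  morphisms rep_l2 Abs_l2
proof (rule part_equivpI)
  show "\<exists>f. sq_integrable f \<and> sq_integrable f \<and> (AE z in circle. f z = f z)"
    using sq_integrable_zero by auto
qed (auto intro!: sympI transpI elim: AE_mp)

text \<open>The inner product is conjugate linear in the second argument.\<close>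

lift_definition cinner :: "l2 \<Rightarrow> l2 \<Rightarrow> complex"
  is "\<lambda>f g. LINT z|circle. f z * cnj (g z)"
  by (intro integral_cong_AE borel_measurable_integrable sq_integrable_mult sq_integrable_cnj)
     auto

lift_definition scaleC :: "complex \<Rightarrow> l2 \<Rightarrow> l2" is "\<lambda>c f z. c * f z"
  by (auto intro: sq_integrable_scale elim: AE_mp)

text \<open>The value for symbols outside \<open>Linf\<close> is a dummy.\<close>

lift_definition Mult :: "(complex \<Rightarrow> complex) \<Rightarrow> l2 \<Rightarrow> l2"
  is "\<lambda>a f. if a \<in> Linf then (\<lambda>z. a z * f z) else (\<lambda>_. 0)"
  by (auto simp: sq_integrable_zero intro: sq_integrable_Linf_mult elim: AE_mp)

instantiation l2 :: real_inner
begin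

lift_definition zero_l2 :: l2 is "\<lambda>_. 0"
  by (simp add: sq_integrable_zero)

lift_definition plus_l2 :: "l2 \<Rightarrow> l2 \<Rightarrow> l2" is "\<lambda>f g z. f z + g z"
  by (auto intro: sq_integrable_add)

lift_definition uminus_l2 :: "l2 \<Rightarrow> l2" is "\<lambda>f z. - f z"
  by (auto simp: sq_integrable_def)

definition minus_l2 :: "l2 \<Rightarrow> l2 \<Rightarrow> l2" where "minus_l2 f g = f + - g"

lift_definition scaleR_l2 :: "real \<Rightarrow> l2 \<Rightarrow> l2" is "\<lambda>r f z. r *\<^sub>R f z"
  by (auto intro: sq_integrable_scaleR)

definition inner_l2 :: "l2 \<Rightarrow> l2 \<Rightarrow> real" where "inner_l2 f g = Re (cinner f g)"
definition norm_l2 :: "l2 \<Rightarrow> real" where "norm_l2 f = sqrt (inner f f)"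
definition dist_l2 :: "l2 \<Rightarrow> l2 \<Rightarrow> real" where "dist_l2 f g = norm (f - g)"
definition sgn_l2 :: "l2 \<Rightarrow> l2" where "sgn_l2 f = inverse (norm f) *\<^sub>R f"
definition uniformity_l2 :: "(l2 \<times> l2) filter" where
  "uniformity_l2 = (INF e\<in>{0<..}. principal {(f, g). dist f g < e})"
definition open_l2 :: "l2 set \<Rightarrow> bool" where
  "open_l2 U \<longleftrightarrow> (\<forall>x\<in>U. \<forall>\<^sub>F (x', y) in uniformity. x' = x \<longrightarrow> y \<in> U)"

instance
proof
  fix f g h :: l2 and r s :: real
  show "f + g + h = f + (g + h)" by transfer (auto intro: sq_integrable_add simp: add.assoc)
  show "f + g = g + f" by transfer (auto intro: sq_integrable_add simp: add.commute)
  show "0 + f = f" by transfer auto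
  show "- f + f = 0" by transfer (auto simp: sq_integrable_zero)
  show "f - g = f + - g" by (simp add: minus_l2_def)
  show "r *\<^sub>R (f + g) = r *\<^sub>R f + r *\<^sub>R g"
    by transfer (auto simp: scaleR_add_right scaleR_add_left
        intro!: sq_integrable_add sq_integrable_scaleR)
  show "(r + s) *\<^sub>R f = r *\<^sub>R f + s *\<^sub>R f"
    by transfer (auto simp: scaleR_add_right scaleR_add_left
        intro!: sq_integrable_add sq_integrable_scaleR)
  show "r *\<^sub>R s *\<^sub>R f = (r * s) *\<^sub>R f"
    by transfer (auto intro!: sq_integrable_scaleR)
  show "1 *\<^sub>R f = f" by transfer auto
  show "dist f g = norm (f - g)" by (rule dist_l2_def)
  show "sgn f = inverse (norm f) *\<^sub>R f" by (rule sgn_l2_def)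
  show "(uniformity :: (l2 \<times> l2) filter) = (INF e\<in>{0<..}. principal {(f, g). dist f g < e})"
    by (rule uniformity_l2_def)
  show "open U \<longleftrightarrow> (\<forall>x\<in>U. \<forall>\<^sub>F (x', y) in uniformity. x' = x \<longrightarrow> y \<in> U)" for U :: "l2 set"
    by (rule open_l2_def)
  show "norm f = sqrt (inner f f)" by (rule norm_l2_def)
  show "inner f g = inner g f"
    unfolding inner_l2_def
  proof transfer
    fix f g :: "complex \<Rightarrow> complex"
    have "(LINT z|circle. f z * cnj (g z)) = (LINT z|circle. cnj (g z * cnj (f z)))"
      by (simp add: mult.commute)
    also have "\<dots> = cnj (LINT z|circle. g z * cnj (f z))" by (rule Bochner_Integration.integral_cnj)
    finally show "Re (LINT z|circle. f z * cnj (g z)) = Re (LINT z|circle. g z * cnj (f z))"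
      by simp
  qed
  show "inner (f + g) h = inner f h + inner g h"
    unfolding inner_l2_def
    by transfer (simp add: distrib_right sq_integrable_mult sq_integrable_cnj)
  show "inner (r *\<^sub>R f) g = r * inner f g"
    unfolding inner_l2_def by transfer simp
  have sq: "Re (LINT z|circle. f z * cnj (f z)) = (LINT z|circle. (cmod (f z))\<^sup>2)"
    for f :: "complex \<Rightarrow> complex"
    by (simp add: complex_norm_square[symmetric] integral_complex_of_real del: of_real_power)
  show "0 \<le> inner f f"
    unfolding inner_l2_def by transfer (simp only: sq integral_nonneg_AE zero_le_power2 AE_I2)
  show "inner f f = 0 \<longleftrightarrow> f = 0"
    unfolding inner_l2_def
  proof transfer
    fix f :: "complex \<Rightarrow> complex"
    assume f: "sq_integrable f \<and> sq_integrable f \<and> (AE z in circle. f z = f z)"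
    then have "(LINT z|circle. (cmod (f z))\<^sup>2) = 0 \<longleftrightarrow> (AE z in circle. (cmod (f z))\<^sup>2 = 0)"
      by (intro integral_nonneg_eq_0_iff_AE) (auto simp: sq_integrable_def)
    with f show "Re (LINT z|circle. f z * cnj (f z)) = 0 \<longleftrightarrow>
        sq_integrable f \<and> sq_integrable (\<lambda>_. 0) \<and> (AE z in circle. f z = 0)"
      by (simp add: sq sq_integrable_zero)
  qed
qed

end

definition closed_csubspace :: "l2 set \<Rightarrow> bool" where
  "closed_csubspace N \<longleftrightarrow>
     0 \<in> N \<and> (\<forall>f\<in>N. \<forall>g\<in>N. f + g \<in> N) \<and> (\<forall>c. \<forall>f\<in>N. scaleC c f \<in> N) \<and> closed N"

definition proj :: "l2 set \<Rightarrow> l2 \<Rightarrow> l2" where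
  "proj N f = (THE g. g \<in> N \<and> (\<forall>h\<in>N. cinner (f - g) h = 0))"

text \<open>An operator \<open>M \<rightarrow> N\<close> is represented by a function that is \<open>undefined\<close>
  outside \<open>M\<close>, so that operators on \<open>M\<close> agree iff they are equal as functions.\<close>

definition toep :: "(complex \<Rightarrow> complex) \<Rightarrow> l2 set \<Rightarrow> l2 set \<Rightarrow> l2 \<Rightarrow> l2" where
  "toep \<phi> M N = (\<lambda>f\<in>M. proj N (Mult \<phi> f))"

text \<open>The identity \<open>A = E B F\<close>, with \<open>A\<close> acting on \<open>K\<close> and \<open>B\<close> on \<open>H\<close>, is itself a
  similarity: the outer factors are mutually inverse.\<close>

definition similar_via ::
  "l2 set \<Rightarrow> l2 set \<Rightarrow> (l2 \<Rightarrow> l2) \<Rightarrow> (l2 \<Rightarrow> l2) \<Rightarrow> (l2 \<Rightarrow> l2) \<Rightarrow> (l2 \<Rightarrow> l2) \<Rightarrow> bool" where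
  "similar_via K H A E B F \<longleftrightarrow>
     A = compose K E (compose K B F) \<and>
     E \<in> H \<rightarrow> K \<and> F \<in> K \<rightarrow> H \<and>
     compose K E F = (\<lambda>f\<in>K. f) \<and> compose H F E = (\<lambda>h\<in>H. h)"

text \<open>\<open>E = F\<^sup>-\<^sup>1\<close> for \<open>F : K \<rightarrow> H\<close>; bijectivity is part of the definition because
  \<open>inv_into\<close> is total.\<close>

definition is_inverse_op :: "l2 set \<Rightarrow> l2 set \<Rightarrow> (l2 \<Rightarrow> l2) \<Rightarrow> (l2 \<Rightarrow> l2) \<Rightarrow> bool" where
  "is_inverse_op K H F E \<longleftrightarrow> bij_betw F K H \<and> E = (\<lambda>h\<in>H. inv_into K F h)"

end

theory Submission
  imports Defs
begin

text \<open>Write \<open>b = 1 / a\<^sub>1\<close> and \<open>c = cnj a\<^sub>2\<close>. Since \<open>a\<^sub>1 K = H\<close>, the operator \<open>F\<close> is just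
  multiplication by \<open>a\<^sub>1\<close>, a bijection of \<open>K\<close> onto \<open>H\<close> whose inverse is multiplication by \<open>b\<close>.
  The factorization through \<open>E\<close> and \<open>F\<close> always holds (\<open>toep_factorization\<close>), so for it to be a
  similarity means no more than that \<open>E\<close> is the inverse of \<open>F\<close>
  (\<open>similar_via_iff_is_inverse_op\<close>), i.e. \<open>P\<^sub>K (c h) = b h\<close> for all \<open>h \<in> H\<close>, which is the
  vanishing of the operator from \<open>H\<close> to \<open>K\<close> with symbol \<open>c - b\<close>.

  A Toeplitz operator vanishes iff its sesquilinear form \<open>\<langle>\<theta> f, g\<rangle>\<close> does
  (\<open>toep_eq_zero_iff\<close>). So all four vanishing conditions can be compared on the level of forms:
  substituting \<open>h = a\<^sub>1 f\<close> in the first slot multiplies the symbol by \<open>a\<^sub>1\<close>, and substituting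
  \<open>g = a\<^sub>2 k\<close> in the second slot multiplies it by \<open>c\<close>. By such substitutions each of the
  symbols \<open>c - b\<close>, \<open>1 / c - a\<^sub>1\<close> and \<open>1 - b / c\<close> becomes \<open>1 - c a\<^sub>1\<close> up to sign, with both slots
  ranging over \<open>K\<close>. The same adjoint computation gives the factorization: for \<open>k \<in> K\<close>,
  \<open>\<langle>c P\<^sub>H u, k\<rangle> = \<langle>P\<^sub>H u, a\<^sub>2 k\<rangle> = \<langle>u, a\<^sub>2 k\<rangle> = \<langle>c u, k\<rangle>\<close> because \<open>a\<^sub>2 k \<in> H\<close>
  (\<open>proj_Mult_cnj_proj\<close>).

  All this needs the projections to exist, since \<open>proj\<close> is a definite description. The analytic
  part is therefore the completeness of \<open>L\<^sup>2\<close> (\<open>riesz_fischer_square\<close>) and the projection theorem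
  in a complete inner product space (\<open>orthogonal_projection_exists\<close>).\<close>

section \<open>Completeness of the space of square-integrable functions\<close>

text \<open>On a finite measure space convergence in square mean dominates convergence in mean, so a
  Cauchy sequence in square mean has a subsequence that converges almost everywhere. Fatou's lemma,
  applied along that subsequence, shows that the pointwise limit is also the limit in square
  mean. Integrability of \<open>(norm (f i - g))\<^sup>2\<close> is part of the conclusion because the Bochner integral of a
  function that is not integrable is \<open>0\<close>.\<close>

lemma (in finite_measure) riesz_fischer_square:
  fixes f :: "nat \<Rightarrow> 'a \<Rightarrow> 'b :: {banach, second_countable_topology}"
  assumes [measurable]: "\<And>n. f n \<in> borel_measurable M"
    and sq: "\<And>n. integrable M (\<lambda>x. (norm (f n x))\<^sup>2)"
    and Cauchy: "\<And>e. e > 0 \<Longrightarrow> \<exists>N. \<forall>i\<ge>N. \<forall>j\<ge>N. (LINT x|M. (norm (f i x - f j x))\<^sup>2) < e"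
  obtains g where "g \<in> borel_measurable M"
    "\<And>e. e > 0 \<Longrightarrow> \<exists>N. \<forall>i\<ge>N. integrable M (\<lambda>x. (norm (f i x - g x))\<^sup>2)
        \<and> (LINT x|M. (norm (f i x - g x))\<^sup>2) \<le> e"
proof -
  have sq_diff: "integrable M (\<lambda>x. (norm (f i x - f j x))\<^sup>2)" for i j
  proof (rule Bochner_Integration.integrable_bound)
    show "integrable M (\<lambda>x. 2 * (norm (f i x))\<^sup>2 + 2 * (norm (f j x))\<^sup>2)"
      using sq by simp
    have "(norm (f i x - f j x))\<^sup>2 \<le> 2 * (norm (f i x))\<^sup>2 + 2 * (norm (f j x))\<^sup>2" for x
    proof -
      have "(norm (f i x - f j x))\<^sup>2 \<le> (norm (f i x) + norm (f j x))\<^sup>2"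
        by (intro power_mono norm_triangle_ineq4) auto
      also have "\<dots> \<le> 2 * (norm (f i x))\<^sup>2 + 2 * (norm (f j x))\<^sup>2"
        using sum_squares_bound[of "norm (f i x)" "norm (f j x)"] by (simp add: power2_sum)
      finally show ?thesis .
    qed
    then show "AE x in M. norm ((norm (f i x - f j x))\<^sup>2)
        \<le> norm (2 * (norm (f i x))\<^sup>2 + 2 * (norm (f j x))\<^sup>2)" by simp
  qed measurable
  \<comment> \<open>Integrated, this bounds the mean by the square mean, with a parameter \<open>t\<close> to balance
    the two terms.\<close>
  have am_gm: "y \<le> t / 2 + y\<^sup>2 / (2 * t)" if "t > 0" for y t :: real
  proof -
    have "0 \<le> (y - t)\<^sup>2 / (2 * t)" using that by simp
    also have "\<dots> = t / 2 + y\<^sup>2 / (2 * t) - y"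
      using that by (simp add: field_simps power2_eq_square)
    finally show ?thesis by simp
  qed
  have int: "integrable M (f n)" for n
  proof (rule Bochner_Integration.integrable_bound)
    show "integrable M (\<lambda>x. 1 / 2 + (norm (f n x))\<^sup>2 / (2 * 1))" using sq by simp
    show "AE x in M. norm (f n x) \<le> norm (1 / 2 + (norm (f n x))\<^sup>2 / (2 * 1))"
      using am_gm[of 1 "norm (f n x)" for x] by (intro AE_I2) simp
  qed measurable
  have "\<exists>N. \<forall>i\<ge>N. \<forall>j\<ge>N. (LINT x|M. norm (f i x - f j x)) < e" if e: "e > 0" for e
  proof -
    define C where "C = measure M (space M)"
    \<comment> \<open>With this \<open>t\<close> each of the two terms of \<open>am_gm\<close> integrates to less than \<open>e / 2\<close>.\<close>
    define t where "t = e / (C + 1)"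
    have C: "C \<ge> 0" by (simp add: C_def)
    have t: "t > 0" using e C by (simp add: t_def)
    have tC: "t * C < e" using e C by (simp add: t_def divide_simps)
    obtain N where N: "\<And>i j. i \<ge> N \<Longrightarrow> j \<ge> N \<Longrightarrow>
        (LINT x|M. (norm (f i x - f j x))\<^sup>2) < t * e"
      using Cauchy[OF mult_pos_pos[OF t e]] by blast
    have "(LINT x|M. norm (f i x - f j x)) < e" if "i \<ge> N" "j \<ge> N" for i j
    proof -
      have "(LINT x|M. norm (f i x - f j x))
          \<le> (LINT x|M. t / 2 + (norm (f i x - f j x))\<^sup>2 / (2 * t))"
        using int sq_diff am_gm[OF t] by (intro integral_mono) auto
      also have "\<dots> = t * C / 2 + (LINT x|M. (norm (f i x - f j x))\<^sup>2) / (2 * t)"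
        using sq_diff by (simp add: C_def)
      also have "\<dots> < e / 2 + t * e / (2 * t)"
        using tC N[OF that] t by (intro add_strict_mono divide_strict_right_mono) auto
      also have "\<dots> = e" using t by simp
      finally show ?thesis .
    qed
    then show ?thesis by blast
  qed
  then obtain r where r: "strict_mono r" "AE x in M. Cauchy (\<lambda>i. f (r i) x)"
    using cauchy_L1_AE_cauchy_subseq[of M f] int by blast
  define g where "g x = lim (\<lambda>i. f (r i) x)" for x
  have [measurable]: "g \<in> borel_measurable M"
    unfolding g_def by measurable
  have lim: "AE x in M. (\<lambda>i. f (r i) x) \<longlonglongrightarrow> g x"
    using r(2) by eventually_elim (simp add: g_def Cauchy_convergent_iff convergent_LIMSEQ_iff)
  have "\<exists>N. \<forall>i\<ge>N. integrable M (\<lambda>x. (norm (f i x - g x))\<^sup>2)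
        \<and> (LINT x|M. (norm (f i x - g x))\<^sup>2) \<le> e" if e: "e > 0" for e
  proof -
    obtain N where N: "\<And>i j. i \<ge> N \<Longrightarrow> j \<ge> N \<Longrightarrow> (LINT x|M. (norm (f i x - f j x))\<^sup>2) < e"
      using Cauchy[OF e] by blast
    have "integrable M (\<lambda>x. (norm (f i x - g x))\<^sup>2) \<and> (LINT x|M. (norm (f i x - g x))\<^sup>2) \<le> e"
      if i: "i \<ge> N" for i
    proof -
      have "(\<integral>\<^sup>+x. ennreal ((norm (f i x - g x))\<^sup>2) \<partial>M)
          = (\<integral>\<^sup>+x. liminf (\<lambda>j. ennreal ((norm (f i x - f (r j) x))\<^sup>2)) \<partial>M)"
      proof (rule nn_integral_cong_AE)
        show "AE x in M. ennreal ((norm (f i x - g x))\<^sup>2)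
            = liminf (\<lambda>j. ennreal ((norm (f i x - f (r j) x))\<^sup>2))"
          using lim
        proof eventually_elim
          case (elim x)
          have "(\<lambda>j. ennreal ((norm (f i x - f (r j) x))\<^sup>2))
              \<longlonglongrightarrow> ennreal ((norm (f i x - g x))\<^sup>2)"
            using elim by (intro tendsto_intros)
          then show ?case by (rule lim_imp_Liminf[OF trivial_limit_sequentially, symmetric])
        qed
      qed
      also have "\<dots> \<le> liminf (\<lambda>j. \<integral>\<^sup>+x. ennreal ((norm (f i x - f (r j) x))\<^sup>2) \<partial>M)"
        by (rule nn_integral_liminf) measurable
      also have "\<dots> \<le> liminf (\<lambda>j. ennreal e)"
      proof (rule Liminf_mono)
        show "\<forall>\<^sub>F j in sequentially. (\<integral>\<^sup>+x. ennreal ((norm (f i x - f (r j) x))\<^sup>2) \<partial>M) \<le> ennreal e"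
          using eventually_ge_at_top[of N]
        proof eventually_elim
          case (elim j)
          then have "r j \<ge> N" using seq_suble[OF r(1), of j] by simp
          then show ?case
            using N[OF i, of "r j"] e
            by (subst nn_integral_eq_integral) (auto simp: sq_diff intro!: ennreal_leI)
        qed
      qed
      also have "\<dots> = ennreal e" by (simp add: Liminf_const)
      finally have le: "(\<integral>\<^sup>+x. ennreal ((norm (f i x - g x))\<^sup>2) \<partial>M) \<le> ennreal e" .
      then have "integrable M (\<lambda>x. (norm (f i x - g x))\<^sup>2)"
        by (intro integrableI_bounded) (auto intro: le_less_trans[OF _ ennreal_less_top])
      with le e show ?thesis by (simp add: nn_integral_eq_integral)
    qed
    then show ?thesis by blast
  qed
  then show thesis by (intro that[of g]) auto
qed

section \<open>Orthogonal projections in complete inner product spaces\<close>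

text \<open>A minimizing sequence for the distance of \<open>x\<close> to \<open>S\<close> is Cauchy by the parallelogram law,
  because the midpoints of its members are not closer to \<open>x\<close> than the infimum. For its limit \<open>q\<close>, a
  closest point, \<open>x - q\<close> makes an obtuse or right angle with every direction \<open>h\<close> in \<open>S\<close>; with
  both \<open>h\<close> and \<open>- h\<close> the angle is right.\<close>

lemma orthogonal_projection_exists:
  fixes S :: "'a :: {real_inner, complete_space} set"
  assumes sub: "subspace S" and cl: "closed S"
  shows "\<exists>p\<in>S. \<forall>h\<in>S. inner (x - p) h = 0"
proof -
  define d where "d = infdist x S"
  have ne: "S \<noteq> {}" using subspace_0[OF sub] by blast
  have d0: "d \<ge> 0" by (simp add: d_def infdist_nonneg)
  have d_le: "d\<^sup>2 \<le> (norm (x - p))\<^sup>2" if "p \<in> S" for p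
    using infdist_le[OF that, of x] d0 by (intro power_mono) (simp_all add: d_def dist_norm)
  have "\<exists>p\<in>S. (norm (x - p))\<^sup>2 < d\<^sup>2 + e" if "e > 0" for e
  proof -
    have "sqrt (d\<^sup>2 + e) > d" using d0 that by (intro real_less_rsqrt) simp
    then obtain p where "p \<in> S" "dist x p < sqrt (d\<^sup>2 + e)"
      using ne cInf_lessD[of "dist x ` S" "sqrt (d\<^sup>2 + e)"]
      unfolding d_def infdist_def by auto
    then have "(norm (x - p))\<^sup>2 < (sqrt (d\<^sup>2 + e))\<^sup>2"
      by (intro power_strict_mono) (auto simp: dist_norm)
    also have "\<dots> = d\<^sup>2 + e" using that by simp
    finally show ?thesis using \<open>p \<in> S\<close> by blast
  qed
  then have "\<exists>p\<in>S. (norm (x - p))\<^sup>2 < d\<^sup>2 + inverse (real (Suc n))" for n by simp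
  then obtain p where pS: "\<And>n. p n \<in> S"
    and p: "\<And>n. (norm (x - p n))\<^sup>2 < d\<^sup>2 + inverse (real (Suc n))"
    by metis
  have gap: "(norm (p m - p n))\<^sup>2 \<le> 2 * inverse (real (Suc m)) + 2 * inverse (real (Suc n))" for m n
  proof -
    have mid: "(1 / 2) *\<^sub>R (p m + p n) \<in> S"
      using sub pS by (intro subspace_scale subspace_add)
    have "(norm (p m - p n))\<^sup>2
        = 2 * (norm (x - p m))\<^sup>2 + 2 * (norm (x - p n))\<^sup>2
          - 4 * (norm (x - (1 / 2) *\<^sub>R (p m + p n)))\<^sup>2"
      by (simp add: power2_norm_eq_inner inner_diff_left inner_diff_right inner_add_left
          inner_add_right inner_commute algebra_simps)
    with d_le[OF mid] p[of m] p[of n] show ?thesis by linarith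
  qed
  have "Cauchy p"
  proof (rule metric_CauchyI)
    fix e :: real assume e: "e > 0"
    obtain N where N: "inverse (real (Suc N)) < e\<^sup>2 / 4"
      using reals_Archimedean[of "e\<^sup>2 / 4"] e by auto
    have "dist (p m) (p n) < e" if "m \<ge> N" "n \<ge> N" for m n
    proof -
      have "inverse (real (Suc m)) \<le> inverse (real (Suc N))"
        "inverse (real (Suc n)) \<le> inverse (real (Suc N))"
        using that by (auto intro!: le_imp_inverse_le)
      then have "(norm (p m - p n))\<^sup>2 < e\<^sup>2" using gap[of m n] N by linarith
      then show ?thesis using e by (simp add: dist_norm power2_less_imp_less)
    qed
    then show "\<exists>N. \<forall>m\<ge>N. \<forall>n\<ge>N. dist (p m) (p n) < e" by blast
  qed
  then obtain q where q: "p \<longlonglongrightarrow> q"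
    using Cauchy_convergent convergent_def by blast
  have qS: "q \<in> S" using closed_sequentially[OF cl] pS q by blast
  have "(norm (x - q))\<^sup>2 \<le> d\<^sup>2"
  proof (rule LIMSEQ_le)
    show "(\<lambda>n. (norm (x - p n))\<^sup>2) \<longlonglongrightarrow> (norm (x - q))\<^sup>2"
      using q by (intro tendsto_intros)
    show "(\<lambda>n. d\<^sup>2 + inverse (real (Suc n))) \<longlonglongrightarrow> d\<^sup>2"
      using tendsto_add[OF tendsto_const LIMSEQ_inverse_real_of_nat] by auto
    show "\<exists>N. \<forall>n\<ge>N. (norm (x - p n))\<^sup>2 \<le> d\<^sup>2 + inverse (real (Suc n))"
      using p less_imp_le by blast
  qed
  then have "norm (x - q) \<le> d" using d0 by (rule power2_le_imp_le)
  then have closest: "\<forall>z\<in>S. dist x q \<le> dist x z"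
    using infdist_le[of _ S x] by (fastforce simp: d_def dist_norm)
  have le: "inner (x - q) h \<le> 0" if "h \<in> S" for h
    using any_closest_point_dot[OF subspace_imp_convex[OF sub] cl qS _ closest, of "q + h"]
      subspace_add[OF sub qS that] by simp
  have "inner (x - q) h = 0" if "h \<in> S" for h
    using le[OF that] le[OF subspace_neg[OF sub that]] by simp
  with qS show ?thesis by blast
qed

section \<open>Completeness of the space of classes\<close>

lemma finite_measure_circle: "finite_measure circle"
proof -
  interpret U: finite_measure "uniform_measure lborel {0..2 * pi}"
    by (rule finite_measureI) simp
  have "cis \<in> borel_measurable borel"
    by (intro borel_measurable_continuous_onI continuous_intros)
  then have cis: "cis \<in> borel_measurable (uniform_measure lborel {0..2 * pi})"
    by (simp cong: measurable_cong_sets)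
  show ?thesis
    unfolding circle_def
    using measurable_restrict_space2[OF _ cis] by (intro U.finite_measure_distr) auto
qed


lemma norm_l2_square: "(norm f)\<^sup>2 = (LINT z|circle. (cmod (rep_l2 f z))\<^sup>2)"
proof -
  have "(norm f)\<^sup>2 = Re (LINT z|circle. rep_l2 f z * cnj (rep_l2 f z))"
    by (simp add: power2_norm_eq_inner inner_l2_def cinner.rep_eq)
  also have "\<dots> = (LINT z|circle. (cmod (rep_l2 f z))\<^sup>2)"
    by (simp add: complex_norm_square[symmetric] integral_complex_of_real del: of_real_power)
  finally show ?thesis .
qed

lemma sq_integrable_rep: "sq_integrable (rep_l2 f)"
  using Quotient_rep_reflp[OF Quotient_l2] by blast

lemma rep_Abs_l2: "sq_integrable f \<Longrightarrow> AE z in circle. rep_l2 (Abs_l2 f) z = f z"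
  using Quotient_rep_abs[OF Quotient_l2, of f] by auto

lemma rep_diff_l2: "AE z in circle. rep_l2 (f - g) z = rep_l2 f z - rep_l2 g z"
proof -
  have "AE z in circle. rep_l2 (f + - g) z = rep_l2 f z + rep_l2 (- g) z"
    unfolding plus_l2_def
    by simp (intro rep_Abs_l2 sq_integrable_add sq_integrable_rep)
  moreover have "AE z in circle. rep_l2 (- g) z = - rep_l2 g z"
    unfolding uminus_l2_def using sq_integrable_rep[of g]
    by simp (intro rep_Abs_l2, auto simp: sq_integrable_def)
  ultimately show ?thesis unfolding minus_l2_def by eventually_elim simp
qed

lemma rep_measurable: "rep_l2 f \<in> borel_measurable circle"
  using sq_integrable_rep by (simp add: sq_integrable_def)

lemma norm_diff_l2_square:
  "(norm (f - g))\<^sup>2 = (LINT z|circle. (cmod (rep_l2 f z - rep_l2 g z))\<^sup>2)"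
  unfolding norm_l2_square
proof (rule integral_cong_AE)
  show "AE z in circle. (cmod (rep_l2 (f - g) z))\<^sup>2 = (cmod (rep_l2 f z - rep_l2 g z))\<^sup>2"
    using rep_diff_l2[of f g] by eventually_elim simp
qed (use rep_measurable in measurable)

instance l2 :: complete_space
proof
  fix X :: "nat \<Rightarrow> l2" assume X: "Cauchy X"
  interpret finite_measure circle by (rule finite_measure_circle)
  have "\<exists>N. \<forall>i\<ge>N. \<forall>j\<ge>N. (LINT z|circle. (cmod (rep_l2 (X i) z - rep_l2 (X j) z))\<^sup>2) < e"
    if e: "e > 0" for e
  proof -
    obtain N where N: "\<And>i j. i \<ge> N \<Longrightarrow> j \<ge> N \<Longrightarrow> dist (X i) (X j) < sqrt e"
      using metric_CauchyD[OF X, of "sqrt e"] e by auto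
    have "(norm (X i - X j))\<^sup>2 < e" if "i \<ge> N" "j \<ge> N" for i j
      using power_strict_mono[OF N[OF that], of 2] e by (simp add: dist_norm)
    then show ?thesis unfolding norm_diff_l2_square by blast
  qed
  then obtain g where [measurable]: "g \<in> borel_measurable circle"
    and g: "\<And>e. e > 0 \<Longrightarrow> \<exists>N. \<forall>i\<ge>N. integrable circle (\<lambda>z. (cmod (rep_l2 (X i) z - g z))\<^sup>2)
        \<and> (LINT z|circle. (cmod (rep_l2 (X i) z - g z))\<^sup>2) \<le> e"
    using riesz_fischer_square[of "\<lambda>n. rep_l2 (X n)"] sq_integrable_rep
    unfolding sq_integrable_def by blast
  have "sq_integrable g"
  proof -
    obtain i where "integrable circle (\<lambda>z. (cmod (rep_l2 (X i) z - g z))\<^sup>2)"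
      using g[of 1] by auto
    then have "sq_integrable (\<lambda>z. - 1 * (rep_l2 (X i) z - g z))"
      by (intro sq_integrable_scale) (use rep_measurable in \<open>simp add: sq_integrable_def\<close>)
    from sq_integrable_add[OF sq_integrable_rep[of "X i"] this] show ?thesis by simp
  qed
  note G = rep_Abs_l2[OF this]
  have "X \<longlonglongrightarrow> Abs_l2 g"
  proof (rule metric_LIMSEQ_I)
    fix e :: real assume e: "e > 0"
    obtain N where N: "\<And>i. i \<ge> N \<Longrightarrow>
        (LINT z|circle. (cmod (rep_l2 (X i) z - g z))\<^sup>2) \<le> (e / 2)\<^sup>2"
      using g[of "(e / 2)\<^sup>2"] e by auto
    have "dist (X i) (Abs_l2 g) < e" if "i \<ge> N" for i
    proof -
      have "(norm (X i - Abs_l2 g))\<^sup>2 = (LINT z|circle. (cmod (rep_l2 (X i) z - g z))\<^sup>2)"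
        unfolding norm_diff_l2_square
      proof (rule integral_cong_AE)
        show "AE z in circle. (cmod (rep_l2 (X i) z - rep_l2 (Abs_l2 g) z))\<^sup>2
            = (cmod (rep_l2 (X i) z - g z))\<^sup>2"
          using G by eventually_elim simp
      qed (use rep_measurable in measurable)
      then have "(norm (X i - Abs_l2 g))\<^sup>2 \<le> (e / 2)\<^sup>2" using N[OF that] by simp
      then have "norm (X i - Abs_l2 g) \<le> e / 2" by (rule power2_le_imp_le) (use e in simp)
      then show ?thesis using e by (simp add: dist_norm)
    qed
    then show "\<exists>N. \<forall>i\<ge>N. dist (X i) (Abs_l2 g) < e" by blast
  qed
  then show "convergent X" by (rule convergentI)
qed

section \<open>Inner product and multiplication operators\<close>

lemma cinner_add_left: "cinner (f + g) h = cinner f h + cinner g h"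
  by transfer (simp add: distrib_right sq_integrable_mult sq_integrable_cnj)

lemma cinner_minus_left: "cinner (- f) h = - cinner f h"
  by transfer simp

lemma cinner_diff_left: "cinner (f - g) h = cinner f h - cinner g h"
  using cinner_add_left[of f "- g" h] by (simp add: cinner_minus_left)

lemma cinner_zero_left: "cinner 0 h = 0"
  by transfer simp

lemma cinner_scaleC_right: "cinner f (scaleC c h) = cnj c * cinner f h"
proof transfer
  fix f h :: "complex \<Rightarrow> complex" and c :: complex
  have "(LINT z|circle. f z * cnj (c * h z)) = (LINT z|circle. cnj c * (f z * cnj (h z)))"
    by (simp add: mult_ac)
  then show "(LINT z|circle. f z * cnj (c * h z)) = cnj c * (LINT z|circle. f z * cnj (h z))"
    by (simp only: integral_mult_right_zero)
qed

lemma scaleC_of_real: "scaleC (of_real r) f = r *\<^sub>R f"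
  by transfer (auto simp: scaleR_conv_of_real intro: sq_integrable_scale)

lemma Linf_mult: "a \<in> Linf \<Longrightarrow> b \<in> Linf \<Longrightarrow> (\<lambda>z. a z * b z) \<in> Linf"
proof -
  assume ab: "a \<in> Linf" "b \<in> Linf"
  obtain A B where A: "AE z in circle. cmod (a z) \<le> A" and B: "AE z in circle. cmod (b z) \<le> B"
    using ab by (auto simp: Linf_def)
  from A B have "AE z in circle. cmod (a z * b z) \<le> A * B"
  proof eventually_elim
    case (elim z)
    then show ?case
      unfolding norm_mult by (intro mult_mono) (auto intro: order_trans[OF norm_ge_zero])
  qed
  with ab show ?thesis by (auto simp: Linf_def)
qed

lemma Linf_diff: "a \<in> Linf \<Longrightarrow> b \<in> Linf \<Longrightarrow> (\<lambda>z. a z - b z) \<in> Linf"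
proof -
  assume ab: "a \<in> Linf" "b \<in> Linf"
  obtain A B where A: "AE z in circle. cmod (a z) \<le> A" and B: "AE z in circle. cmod (b z) \<le> B"
    using ab by (auto simp: Linf_def)
  from A B have "AE z in circle. cmod (a z - b z) \<le> A + B"
    by eventually_elim (metis add_mono norm_triangle_ineq4 order_trans)
  with ab show ?thesis by (auto simp: Linf_def)
qed

lemma Linf_cnj: "a \<in> Linf \<Longrightarrow> (\<lambda>z. cnj (a z)) \<in> Linf"
proof -
  assume a: "a \<in> Linf"
  then have "a \<in> borel_measurable circle" by (simp add: Linf_def)
  then have "(\<lambda>z. cnj (a z)) \<in> borel_measurable circle"
    by (rule borel_measurable_continuous_on[rotated]) (intro continuous_intros)
  with a show ?thesis by (simp add: Linf_def)
qed

lemma GLinf_D: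
  assumes "g \<in> GLinf"
  shows "g \<in> Linf" "(\<lambda>z. inverse (g z)) \<in> Linf" "AE z in circle. g z \<noteq> 0"
  using assms by (auto simp: GLinf_def inverse_eq_divide)

lemma GLinf_cnj: "g \<in> GLinf \<Longrightarrow> (\<lambda>z. cnj (g z)) \<in> GLinf"
  using Linf_cnj[of g] Linf_cnj[of "\<lambda>z. 1 / g z"] by (simp add: GLinf_def)

lemma Mult_cong_AE:
  assumes "a \<in> Linf" "b \<in> Linf" "AE z in circle. a z = b z"
  shows "Mult a f = Mult b f"
  using assms by transfer (auto intro: sq_integrable_Linf_mult elim: AE_mp)

lemma Mult_Mult:
  assumes "a \<in> Linf" "b \<in> Linf"
  shows "Mult a (Mult b f) = Mult (\<lambda>z. a z * b z) f"
  using assms Linf_mult[OF assms]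
  by transfer (auto simp: mult.assoc intro!: sq_integrable_Linf_mult)

lemma Mult_one: "Mult (\<lambda>_. 1) f = f"
  using const_in_Linf[of 1] by transfer simp

lemma Mult_diff:
  assumes "a \<in> Linf" "b \<in> Linf"
  shows "Mult (\<lambda>z. a z - b z) f = Mult a f - Mult b f"
proof -
  have "Mult (\<lambda>z. a z - b z) f + Mult b f = Mult a f"
    using assms Linf_diff[OF assms]
    by transfer (auto simp: left_diff_distrib intro!: sq_integrable_Linf_mult sq_integrable_add)
  then show ?thesis by (simp add: eq_diff_eq)
qed

lemma Mult_diff_right:
  assumes "a \<in> Linf"
  shows "Mult a (f - g) = Mult a f - Mult a g"
proof -
  have "Mult a (u + v) = Mult a u + Mult a v" for u v
    using assms
    by transfer (auto simp: distrib_left intro!: sq_integrable_Linf_mult sq_integrable_add)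
  from this[of "f - g" g] show ?thesis by (simp add: eq_diff_eq)
qed

lemma Mult_inverse:
  assumes "g \<in> GLinf"
  shows "Mult (\<lambda>z. inverse (g z)) (Mult g f) = f"
proof -
  note g = GLinf_D[OF assms]
  have "Mult (\<lambda>z. inverse (g z)) (Mult g f) = Mult (\<lambda>z. inverse (g z) * g z) f"
    using g by (intro Mult_Mult)
  also have "\<dots> = Mult (\<lambda>_. 1) f"
    using g by (intro Mult_cong_AE Linf_mult const_in_Linf) auto
  finally show ?thesis by (simp add: Mult_one)
qed

lemma cinner_Mult_left:
  assumes "a \<in> Linf"
  shows "cinner (Mult a f) g = cinner f (Mult (\<lambda>z. cnj (a z)) g)"
  using assms Linf_cnj[OF assms] by transfer (simp add: mult_ac)

section \<open>Projections and Toeplitz operators\<close>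

lemma closed_csubspace_imp_subspace: "closed_csubspace N \<Longrightarrow> subspace N"
  by (auto simp: closed_csubspace_def subspace_def scaleC_of_real[symmetric])

text \<open>The real inner product is the real part of \<open>cinner\<close>, so the real projection theorem gives
  the vanishing of the real part only. The imaginary part at \<open>h\<close> is the real part at \<open>i h\<close>.\<close>

lemma cinner_projection_exists:
  assumes "closed_csubspace N"
  shows "\<exists>p\<in>N. \<forall>h\<in>N. cinner (f - p) h = 0"
proof -
  have "closed N" using assms by (simp add: closed_csubspace_def)
  with closed_csubspace_imp_subspace[OF assms]
  obtain p where p: "p \<in> N" and re: "\<And>h. h \<in> N \<Longrightarrow> inner (f - p) h = 0"
    using orthogonal_projection_exists by blast
  have "cinner (f - p) h = 0" if "h \<in> N" for h
  proof (rule complex_eqI)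
    show "Re (cinner (f - p) h) = Re 0" using re[OF that] by (simp add: inner_l2_def)
    have "scaleC \<i> h \<in> N" using assms that by (simp add: closed_csubspace_def)
    from re[OF this] show "Im (cinner (f - p) h) = Im 0"
      by (simp add: inner_l2_def cinner_scaleC_right)
  qed
  with p show ?thesis by blast
qed

lemma cinner_projection_unique:
  assumes "closed_csubspace N" "p \<in> N" "q \<in> N"
    and "\<forall>h\<in>N. cinner (f - p) h = 0" "\<forall>h\<in>N. cinner (f - q) h = 0"
  shows "p = q"
proof -
  have "p - q \<in> N"
    using assms(2,3) closed_csubspace_imp_subspace[OF assms(1)] by (simp add: subspace_diff)
  then have "cinner (f - q) (p - q) - cinner (f - p) (p - q) = 0" using assms(4,5) by simp
  then have "cinner (p - q) (p - q) = 0" by (simp add: cinner_diff_left)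
  then have "inner (p - q) (p - q) = 0" by (simp add: inner_l2_def)
  then show ?thesis by simp
qed

text \<open>Unfolds the definite description once and for all. The condition compares inner products
  of \<open>f\<close> and \<open>p\<close> instead of testing \<open>f - p\<close>, so that the adjoint rule for multiplications applies to each side.\<close>

lemma proj_eq_iff:
  assumes N: "closed_csubspace N"
  shows "proj N f = p \<longleftrightarrow> p \<in> N \<and> (\<forall>h\<in>N. cinner f h = cinner p h)"
proof -
  have "\<exists>!g. g \<in> N \<and> (\<forall>h\<in>N. cinner (f - g) h = 0)"
    using cinner_projection_exists[OF N, of f] cinner_projection_unique[OF N] by blast
  from the1_equality[OF this, of p] theI'[OF this]
  show ?thesis unfolding proj_def by (auto simp: cinner_diff_left)
qed

lemma proj_in: "closed_csubspace N \<Longrightarrow> proj N f \<in> N"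
  and cinner_proj: "closed_csubspace N \<Longrightarrow> h \<in> N \<Longrightarrow> cinner (proj N f) h = cinner f h"
  using proj_eq_iff[of N f "proj N f"] by auto

lemma proj_of_mem: "closed_csubspace N \<Longrightarrow> f \<in> N \<Longrightarrow> proj N f = f"
  by (simp add: proj_eq_iff)

lemma proj_zero_iff: "closed_csubspace N \<Longrightarrow> proj N f = 0 \<longleftrightarrow> (\<forall>h\<in>N. cinner f h = 0)"
  by (auto simp: proj_eq_iff cinner_zero_left closed_csubspace_def)

lemma toep_eq_zero_iff:
  assumes "closed_csubspace N"
  shows "toep \<theta> M N = (\<lambda>f\<in>M. 0) \<longleftrightarrow> (\<forall>f\<in>M. \<forall>g\<in>N. cinner (Mult \<theta> f) g = 0)"
  unfolding toep_def fun_eq_iff restrict_def using proj_zero_iff[OF assms] by auto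

lemma toep_in: "closed_csubspace N \<Longrightarrow> toep \<theta> M N \<in> M \<rightarrow> N"
  by (simp add: toep_def proj_in)

text \<open>The adjoint of multiplication by \<open>cnj a\<close> is multiplication by \<open>a\<close>, which maps \<open>K\<close> into
  \<open>H\<close>. Hence the inner product of \<open>cnj a u\<close> with an element of \<open>K\<close> depends only on the component
  of \<open>u\<close> in \<open>H\<close>.\<close>

lemma proj_Mult_cnj_proj:
  assumes H: "closed_csubspace H" and K: "closed_csubspace K"
    and a: "a \<in> Linf" and aK: "Mult a ` K \<subseteq> H"
  shows "proj K (Mult (\<lambda>z. cnj (a z)) (proj H u)) = proj K (Mult (\<lambda>z. cnj (a z)) u)"
proof -
  have "cinner (Mult (\<lambda>z. cnj (a z)) (proj H u)) k = cinner (Mult (\<lambda>z. cnj (a z)) u) k"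
    if "k \<in> K" for k
  proof -
    have "Mult a k \<in> H" using aK that by blast
    then show ?thesis
      using a by (simp add: cinner_Mult_left Linf_cnj cinner_proj[OF H])
  qed
  then show ?thesis by (simp add: proj_eq_iff[OF K] proj_in[OF K] cinner_proj[OF K])
qed

lemma toep_factorization:
  assumes H: "closed_csubspace H" and K: "closed_csubspace K"
    and a: "a \<in> Linf" "b \<in> Linf" and aK: "Mult a ` K \<subseteq> H" "Mult b ` K \<subseteq> H"
    and \<phi>: "\<phi> \<in> Linf" and \<psi>: "\<psi> \<in> Linf"
    and eq: "AE z in circle. \<phi> z = cnj (b z) * \<psi> z * a z"
  shows "toep \<phi> K K = compose K (toep (\<lambda>z. cnj (b z)) H K) (compose K (toep \<psi> H H) (toep a K H))"
proof
  fix f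
  show "toep \<phi> K K f
      = compose K (toep (\<lambda>z. cnj (b z)) H K) (compose K (toep \<psi> H H) (toep a K H)) f"
  proof (cases "f \<in> K")
    case True
    then have af: "Mult a f \<in> H" using aK by blast
    have "compose K (toep (\<lambda>z. cnj (b z)) H K) (compose K (toep \<psi> H H) (toep a K H)) f
        = proj K (Mult (\<lambda>z. cnj (b z)) (proj H (Mult \<psi> (Mult a f))))"
      using True af by (simp add: compose_def toep_def proj_of_mem[OF H] proj_in[OF H])
    also have "\<dots> = proj K (Mult (\<lambda>z. cnj (b z)) (Mult \<psi> (Mult a f)))"
      by (rule proj_Mult_cnj_proj[OF H K a(2) aK(2)])
    also have "Mult (\<lambda>z. cnj (b z)) (Mult \<psi> (Mult a f)) = Mult (\<lambda>z. cnj (b z) * \<psi> z * a z) f"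
      using a \<psi> by (simp add: Mult_Mult Linf_mult Linf_cnj mult.assoc)
    also have "\<dots> = Mult \<phi> f"
      using a \<phi> \<psi> eq by (intro Mult_cong_AE Linf_mult Linf_cnj) auto
    finally show ?thesis using True by (simp add: toep_def[of \<phi>])
  qed (simp add: compose_def toep_def)
qed

text \<open>For a bijective \<open>F\<close> either of the two inverse laws determines \<open>E\<close> on \<open>H\<close>. Extensionality
  fixes \<open>E\<close> outside \<open>H\<close>, as is needed for equality with the restricted inverse.\<close>

lemma similar_via_iff_is_inverse_op:
  assumes A: "A = compose K E (compose K B F)"
    and E: "E \<in> H \<rightarrow> K" "E \<in> extensional H" and F: "bij_betw F K H"
  shows "similar_via K H A E B F \<longleftrightarrow> is_inverse_op K H F E"
proof
  assume "similar_via K H A E B F"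
  then have "compose H F E = (\<lambda>h\<in>H. h)" by (simp add: similar_via_def)
  then have FE: "F (E h) = h" if "h \<in> H" for h
    using that by (metis compose_eq restrict_apply')
  have "E h = inv_into K F h" if "h \<in> H" for h
    using FE[OF that] E(1) that F by (metis PiE bij_betw_inv_into_left)
  then have "E = (\<lambda>h\<in>H. inv_into K F h)"
    using E(2) by (intro extensionalityI[of _ H]) auto
  with F show "is_inverse_op K H F E" by (simp add: is_inverse_op_def)
next
  assume "is_inverse_op K H F E"
  then have Eh: "E h = inv_into K F h" if "h \<in> H" for h
    using that by (simp add: is_inverse_op_def)
  have FK: "F f \<in> H" if "f \<in> K" for f using F that by (rule bij_betwE[THEN bspec])
  have "compose K E F = (\<lambda>f\<in>K. f)"
    using F FK by (auto simp: compose_def Eh fun_eq_iff bij_betw_inv_into_left)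
  moreover have "compose H F E = (\<lambda>h\<in>H. h)"
    using F by (auto simp: compose_def Eh fun_eq_iff bij_betw_inv_into_right)
  ultimately show "similar_via K H A E B F"
    using A E(1) FK by (auto simp: similar_via_def)
qed

lemma Mult_GLinf_bij_betw:
  assumes g: "g \<in> GLinf" and img: "Mult g ` K = H"
  shows "bij_betw (\<lambda>f\<in>K. Mult g f) K H"
    and "h \<in> H \<Longrightarrow> inv_into K (\<lambda>f\<in>K. Mult g f) h = Mult (\<lambda>z. inverse (g z)) h"
proof -
  have inj: "inj_on (\<lambda>f\<in>K. Mult g f) K"
    using Mult_inverse[OF g] by (intro inj_on_inverseI[of _ "Mult (\<lambda>z. inverse (g z))"]) simp
  with img show "bij_betw (\<lambda>f\<in>K. Mult g f) K H" by (auto simp: bij_betw_def)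
  assume "h \<in> H"
  then obtain f where "f \<in> K" "h = Mult g f" using img by blast
  then show "inv_into K (\<lambda>f\<in>K. Mult g f) h = Mult (\<lambda>z. inverse (g z)) h"
    using inj by (intro inv_into_f_eq) (simp_all add: Mult_inverse[OF g])
qed

section \<open>Similarity via multiplications\<close>

theorem proposition2p19:
  fixes H K :: "l2 set" and a\<^sub>1 a\<^sub>2 \<phi> \<psi> :: "complex \<Rightarrow> complex" and E F :: "l2 \<Rightarrow> l2"
  assumes "closed_csubspace H" and "closed_csubspace K"
    and "a\<^sub>1 \<in> GLinf" and "a\<^sub>2 \<in> GLinf"
    and "Mult a\<^sub>1 ` K = H" and "Mult a\<^sub>2 ` K = H"
    and "\<phi> \<in> Linf" and "\<psi> \<in> Linf"
    and "AE z in circle. \<phi> z = cnj (a\<^sub>2 z) * \<psi> z * a\<^sub>1 z"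
    and "E = toep (\<lambda>z. cnj (a\<^sub>2 z)) H K"
    and "F = toep a\<^sub>1 K H"
  shows "F = (\<lambda>f\<in>K. Mult a\<^sub>1 f) \<and>
    toep \<phi> K K = compose K E (compose K (toep \<psi> H H) F) \<and>
    (similar_via K H (toep \<phi> K K) E (toep \<psi> H H) F
      \<longleftrightarrow> is_inverse_op K H F E) \<and>
    (is_inverse_op K H F E
      \<longleftrightarrow> toep (\<lambda>z. cnj (a\<^sub>2 z) - inverse (a\<^sub>1 z)) H K = (\<lambda>h\<in>H. 0)) \<and>
    (is_inverse_op K H F E
      \<longleftrightarrow> toep (\<lambda>z. inverse (cnj (a\<^sub>2 z)) - a\<^sub>1 z) K H = (\<lambda>f\<in>K. 0)) \<and>
    (is_inverse_op K H F E
      \<longleftrightarrow> toep (\<lambda>z. 1 - cnj (a\<^sub>2 z) * a\<^sub>1 z) K K = (\<lambda>f\<in>K. 0)) \<and>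
    (is_inverse_op K H F E
      \<longleftrightarrow> toep (\<lambda>z. 1 - inverse (cnj (a\<^sub>2 z)) * inverse (a\<^sub>1 z)) H H = (\<lambda>h\<in>H. 0))"
proof -
  note H = assms(1) and K = assms(2) and img1 = assms(5) and img2 = assms(6)
  note a1 = GLinf_D[OF assms(3)] and a2 = GLinf_D(1)[OF assms(4)]
  let ?b = "\<lambda>z. inverse (a\<^sub>1 z)" and ?c = "\<lambda>z. cnj (a\<^sub>2 z)" and ?d = "\<lambda>z. inverse (cnj (a\<^sub>2 z))"
  note c = GLinf_D[OF GLinf_cnj[OF assms(4)]]
  note Linf = a1(1,2) c(1,2) const_in_Linf Linf_mult Linf_diff
  have aK: "Mult a\<^sub>1 f \<in> H" if "f \<in> K" for f using img1 that by blast
  have F: "F = (\<lambda>f\<in>K. Mult a\<^sub>1 f)"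
    unfolding assms(11) toep_def by (intro restrict_ext) (simp add: proj_of_mem[OF H] aK)
  have fact: "toep \<phi> K K = compose K E (compose K (toep \<psi> H H) F)"
    unfolding assms(10,11)
    using toep_factorization[OF H K a1(1) a2 _ _ assms(7,8,9)] img1 img2 by simp
  have bij: "bij_betw F K H"
    unfolding F by (rule Mult_GLinf_bij_betw(1)[OF assms(3) img1])
  have a: "similar_via K H (toep \<phi> K K) E (toep \<psi> H H) F \<longleftrightarrow> is_inverse_op K H F E"
    using toep_in[OF K] by (intro similar_via_iff_is_inverse_op[OF fact _ _ bij])
      (simp_all add: assms(10) toep_def)
  \<comment> \<open>The form of symbol \<open>1 - cnj a\<^sub>2 * a\<^sub>1\<close> on \<open>K\<close>, to which every condition is reduced.\<close>
  define Q where "Q \<longleftrightarrow> (\<forall>f\<in>K. \<forall>g\<in>K. cinner (Mult (\<lambda>z. 1 - ?c z * a\<^sub>1 z) f) g = 0)"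
  have inv_b: "Mult ?b h \<in> K" if "h \<in> H" for h
    using that img1 Mult_inverse[OF assms(3)] by auto
  have b: "is_inverse_op K H F E \<longleftrightarrow> (\<forall>h\<in>H. \<forall>k\<in>K. cinner (Mult (\<lambda>z. ?c z - ?b z) h) k = 0)"
  proof -
    have "is_inverse_op K H F E \<longleftrightarrow> (\<forall>h\<in>H. proj K (Mult ?c h) = Mult ?b h)"
      unfolding is_inverse_op_def assms(10) toep_def fun_eq_iff restrict_def
      using bij Mult_GLinf_bij_betw(2)[OF assms(3) img1]
      by (auto simp: F restrict_def)
    also have "\<dots> \<longleftrightarrow> (\<forall>h\<in>H. \<forall>k\<in>K. cinner (Mult (\<lambda>z. ?c z - ?b z) h) k = 0)"
      by (simp add: proj_eq_iff[OF K] inv_b Mult_diff Linf cinner_diff_left)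
    finally show ?thesis .
  qed
  \<comment> \<open>Substitution \<open>h = a\<^sub>1 f\<close> in the first slot.\<close>
  have cQ: "(\<forall>h\<in>H. \<forall>k\<in>K. cinner (Mult (\<lambda>z. ?c z - ?b z) h) k = 0) \<longleftrightarrow> Q"
  proof -
    have "Mult (\<lambda>z. ?c z - ?b z) (Mult a\<^sub>1 f) = - Mult (\<lambda>z. 1 - ?c z * a\<^sub>1 z) f" for f
      by (simp add: Mult_diff Linf Mult_Mult[symmetric] Mult_inverse[OF assms(3)] Mult_one)
    then show ?thesis unfolding Q_def img1[symmetric] by (simp add: cinner_minus_left)
  qed
  have adj: "cinner u (Mult a\<^sub>2 k) = cinner (Mult ?c u) k" for u k
    by (simp add: cinner_Mult_left c)
  have cd: "Mult ?c (Mult ?d u) = u" for u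
    using Mult_Mult[of ?c ?d u] Mult_Mult[of ?d ?c u] Mult_inverse[OF GLinf_cnj[OF assms(4)], of u] c
    by (simp add: mult.commute)
  \<comment> \<open>Substitution \<open>h = a\<^sub>2 k\<close> in the second slot, moved to the first by \<open>adj\<close>.\<close>
  have dQ: "(\<forall>f\<in>K. \<forall>h\<in>H. cinner (Mult (\<lambda>z. ?d z - a\<^sub>1 z) f) h = 0) \<longleftrightarrow> Q"
  proof -
    have "Mult ?c (Mult (\<lambda>z. ?d z - a\<^sub>1 z) f) = Mult (\<lambda>z. 1 - ?c z * a\<^sub>1 z) f" for f
      by (simp add: Mult_diff Mult_diff_right Linf Mult_Mult[symmetric] Mult_one cd)
    then show ?thesis unfolding Q_def img2[symmetric] by (simp add: adj)
  qed
  \<comment> \<open>Both substitutions at once, each for one of the two variables ranging over \<open>H\<close>.\<close>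
  have fQ: "(\<forall>h\<in>H. \<forall>k\<in>H. cinner (Mult (\<lambda>z. 1 - ?d z * ?b z) h) k = 0) \<longleftrightarrow> Q"
  proof -
    have "Mult ?c (Mult (\<lambda>z. 1 - ?d z * ?b z) (Mult a\<^sub>1 f)) = - Mult (\<lambda>z. 1 - ?c z * a\<^sub>1 z) f" for f
      by (simp add: Mult_diff Mult_diff_right Linf Mult_Mult[symmetric] Mult_one cd
          Mult_inverse[OF assms(3)])
    then have "cinner (Mult (\<lambda>z. 1 - ?d z * ?b z) (Mult a\<^sub>1 f)) (Mult a\<^sub>2 k)
        = - cinner (Mult (\<lambda>z. 1 - ?c z * a\<^sub>1 z) f) k" for f k
      by (simp add: adj cinner_minus_left)
    moreover have "(\<forall>h\<in>H. \<forall>k\<in>H. cinner (Mult (\<lambda>z. 1 - ?d z * ?b z) h) k = 0) \<longleftrightarrow>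
        (\<forall>f\<in>K. \<forall>k\<in>K. cinner (Mult (\<lambda>z. 1 - ?d z * ?b z) (Mult a\<^sub>1 f)) (Mult a\<^sub>2 k) = 0)"
    proof -
      have "(\<forall>h\<in>H. P h) \<longleftrightarrow> (\<forall>f\<in>K. P (Mult a\<^sub>1 f))" for P
        unfolding img1[symmetric] by simp
      moreover have "(\<forall>h\<in>H. P h) \<longleftrightarrow> (\<forall>k\<in>K. P (Mult a\<^sub>2 k))" for P
        unfolding img2[symmetric] by simp
      ultimately have "(\<forall>h\<in>H. P h) \<longleftrightarrow> (\<forall>f\<in>K. P (Mult a\<^sub>1 f))"
        "(\<forall>h\<in>H. P h) \<longleftrightarrow> (\<forall>k\<in>K. P (Mult a\<^sub>2 k))" for P
        by blast+
      then show ?thesis by (rule trans[OF _ ball_cong[OF refl]])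
    qed
    ultimately show ?thesis unfolding Q_def by simp
  qed
  show ?thesis
    using F fact a b cQ dQ fQ by (simp add: toep_eq_zero_iff H K Q_def)
qed

end
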